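(* Let $f$ be an arbitrary $4$-interval exchange transformation with monodromy invariant $(4,3,2,1)$ which satisfies the Keane condition. Assume furthermore that $f^2$ is discontinuous at $f^{-1}(0)$. Then $f$ is a new transformation.
   Context: An $n$-interval exchange transformation ($n$-IET) is a bijection $f:[0,1)\to[0,1)$ for which there is a partition of $[0,1)$ into $n$ half-open subintervals $I_1,\dots,I_n$ (closed on the left, open on the right), labeled from left to right, of lengths $\lambda_1,\dots,\lambda_n>0$ with $\sum_i\lambda_i=1$, such that $f$ is a translation on each $I_i$. Its monodromy invariant is the permutation $\rho=(\rho(1),\dots,\rho(n))$ of $\{1,\dots,n\}$, where $\rho(i)$ is the position, counted from the left, of $f(I_i)$ among the image intervals. Thus $\rho=(4,3,2,1)$ means that $f$ inverts the order of its four intervals. An interval exchange transformation is an $n$-IET for some $n\in\mathbb{N}$. Keane condition: writing $\partial I_i$ for the left endpoint of $I_i$, one has $f^m(\partial I_i)\neq\partial I_j$ for all $m\ge1$, all $i\in\{1,\dots,n\}$ and all $j\in\{2,\dots,n\}$. An $n$-IET $h$ is called an old transformation if $h=g\circ f_0\circ g^{-1}$ for some $m$-IET $f_0$ with $m<n$ and some arbitrary interval exchange transformation $g$. Otherwise $h$ is called a new transformation. *)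

theory Defs
  imports Complex_Main
begin

(* A map of [0,1) is a function real => real of which only the values on {0..<1} matter.
   The lengths of the n subintervals are lam 1, ..., lam n (indices start at 1). *)

definition left_endpoint :: "(nat \<Rightarrow> real) \<Rightarrow> nat \<Rightarrow> real" where
  "left_endpoint lam i = (\<Sum>j = 1..<i. lam j)"

definition subinterval :: "(nat \<Rightarrow> real) \<Rightarrow> nat \<Rightarrow> real set" where
  "subinterval lam i = {left_endpoint lam i ..< left_endpoint lam i + lam i}"

(* The partition need not be the coarsest one: f may be continuous at an interior endpoint. *)
definition iet_with_lengths :: "nat \<Rightarrow> (nat \<Rightarrow> real) \<Rightarrow> (real \<Rightarrow> real) \<Rightarrow> bool" where
  "iet_with_lengths n lam f \<longleftrightarrow>
     bij_betw f {0..<1} {0..<1} \<and>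
     (\<forall>i\<in>{1..n}. lam i > 0) \<and> (\<Sum>i = 1..n. lam i) = 1 \<and>
     (\<forall>i\<in>{1..n}. \<exists>t. \<forall>x\<in>subinterval lam i. f x = x + t)"

definition is_iet :: "nat \<Rightarrow> (real \<Rightarrow> real) \<Rightarrow> bool" where
  "is_iet n f \<longleftrightarrow> (\<exists>lam. iet_with_lengths n lam f)"

(* The image of the i-th subinterval is again half-open, with left endpoint
   f (left_endpoint lam i); its position counts the image intervals up to and including it. *)
definition image_position :: "nat \<Rightarrow> (nat \<Rightarrow> real) \<Rightarrow> (real \<Rightarrow> real) \<Rightarrow> nat \<Rightarrow> nat" where
  "image_position n lam f i =
     card {j \<in> {1..n}. f (left_endpoint lam j) \<le> f (left_endpoint lam i)}"

definition monodromy_invariant :: "nat \<Rightarrow> (nat \<Rightarrow> real) \<Rightarrow> (real \<Rightarrow> real) \<Rightarrow> nat list" where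
  "monodromy_invariant n lam f = map (image_position n lam f) [1..<Suc n]"

definition keane :: "nat \<Rightarrow> (nat \<Rightarrow> real) \<Rightarrow> (real \<Rightarrow> real) \<Rightarrow> bool" where
  "keane n lam f \<longleftrightarrow>
     (\<forall>m\<ge>1. \<forall>i\<in>{1..n}. \<forall>j\<in>{2..n}. (f ^^ m) (left_endpoint lam i) \<noteq> left_endpoint lam j)"

definition old_transformation :: "nat \<Rightarrow> (real \<Rightarrow> real) \<Rightarrow> bool" where
  "old_transformation n h \<longleftrightarrow>
     is_iet n h \<and>
     (\<exists>m f0 k g. m < n \<and> is_iet m f0 \<and> is_iet k g \<and>
        (\<forall>x\<in>{0..<1}. h x = g (f0 (inv_into {0..<1} g x))))"

definition new_transformation :: "nat \<Rightarrow> (real \<Rightarrow> real) \<Rightarrow> bool" where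
  "new_transformation n h \<longleftrightarrow> is_iet n h \<and> \<not> old_transformation n h"

end

theory Submission
  imports Defs
begin

text \<open>
  The proof compares how fast the iterates of \<open>f\<close> and of a map with fewer intervals break
  \<open>[0,1)\<close> into pieces.  Call \<open>x \<in> (0,1)\<close> a break of a map if the map is not a translation near
  \<open>x\<close>.  A map with at most three intervals has at most two breaks, and breaks are subadditive
  under composition, so its \<open>n\<close>-th iterate has at most \<open>2 n\<close> of them.  Conjugation by an interval
  exchange \<open>g\<close> changes the number of breaks by at most a constant that depends on \<open>g\<close> alone.
  Hence, if \<open>f\<close> were an old transformation, \<open>f ^^ n\<close> would have at most \<open>2 n + C\<close> breaks.

  On the other hand \<open>f ^^ n\<close> has at least \<open>3 n\<close> breaks, which is a contradiction for large \<open>n\<close>.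
  The candidates are the points \<open>f\<^sup>-\<^sup>k(\<partial>I\<^sub>j)\<close> with \<open>k < n\<close> and \<open>j = 2, 3, 4\<close>, which are pairwise
  distinct by the Keane condition.  What has to be excluded is that a discontinuity of \<open>f\<close> at
  \<open>\<partial>I\<^sub>j\<close> is repaired by later iterations.  For the order-reversing permutation, the
  limits of \<open>f\<close> from the left at \<open>\<partial>I\<^sub>3\<close> and \<open>\<partial>I\<^sub>4\<close> are \<open>f(\<partial>I\<^sub>1)\<close> and \<open>f(\<partial>I\<^sub>2)\<close>, while the limit of
  \<open>f \<circ> f\<close> from the left at \<open>\<partial>I\<^sub>2\<close>, where \<open>f\<close> itself tends to \<open>1\<close>, is \<open>f(\<partial>I\<^sub>3)\<close>.  By the Keane condition the further orbits of these
  limits never meet a discontinuity, so a repair would make two points of \<open>[0,1)\<close> have the same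
  image, or force \<open>f(\<partial>I\<^sub>2) = \<partial>I\<^sub>3\<close>.
\<close>

section \<open>Local translations and breaks\<close>

definition local_translation :: "(real \<Rightarrow> real) \<Rightarrow> real \<Rightarrow> bool" where
  "local_translation h x \<longleftrightarrow> (\<exists>e>0. \<forall>y. \<bar>y - x\<bar> < e \<longrightarrow> h y = h x + (y - x))"

lemma local_translationI:
  "e > 0 \<Longrightarrow> (\<And>y. \<bar>y - x\<bar> < e \<Longrightarrow> h y = h x + (y - x)) \<Longrightarrow> local_translation h x"
  unfolding local_translation_def by blast

text \<open>
  The point \<open>0\<close> is left out because there a map of \<open>[0,1)\<close> has no neighbourhood on the left.
\<close>

definition breaks :: "(real \<Rightarrow> real) \<Rightarrow> real set" where
  "breaks h = {x \<in> {0<..<1}. \<not> local_translation h x}"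

lemma local_translation_comp:
  assumes "local_translation h x" "local_translation k (h x)"
  shows "local_translation (k \<circ> h) x"
proof -
  from assms(1) obtain d where d: "d > 0" "\<And>y. \<bar>y - x\<bar> < d \<Longrightarrow> h y = h x + (y - x)"
    unfolding local_translation_def by blast
  from assms(2) obtain e where e: "e > 0" "\<And>z. \<bar>z - h x\<bar> < e \<Longrightarrow> k z = k (h x) + (z - h x)"
    unfolding local_translation_def by blast
  have eq: "(k \<circ> h) y = (k \<circ> h) x + (y - x)" if "\<bar>y - x\<bar> < min d e" for y
    using that d(2)[of y] e(2)[of "h y"] by simp
  have "min d e > 0" using d(1) e(1) by simp
  then show ?thesis by (rule local_translationI[of "min d e" x "k \<circ> h"]) (rule eq)
qed

text \<open>A local translation is locally invertible, so it can be cancelled on the right.\<close>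

lemma local_translation_cancel:
  assumes "local_translation h x" "local_translation (k \<circ> h) x"
  shows "local_translation k (h x)"
proof -
  from assms(1) obtain d where d: "d > 0" "\<And>y. \<bar>y - x\<bar> < d \<Longrightarrow> h y = h x + (y - x)"
    unfolding local_translation_def by blast
  from assms(2) obtain e where e: "e > 0"
    "\<And>y. \<bar>y - x\<bar> < e \<Longrightarrow> k (h y) = k (h x) + (y - x)"
    unfolding local_translation_def by auto
  have eq: "k z = k (h x) + (z - h x)" if z: "\<bar>z - h x\<bar> < min d e" for z
  proof -
    define y where "y = x + (z - h x)"
    have y: "\<bar>y - x\<bar> < d" "\<bar>y - x\<bar> < e" using z by (simp_all add: y_def)
    have "h y = z" using d(2)[OF y(1)] by (simp add: y_def)
    then show ?thesis using e(2)[OF y(2)] by (simp add: y_def)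
  qed
  have "min d e > 0" using d(1) e(1) by simp
  then show ?thesis by (rule local_translationI[of "min d e" "h x" k]) (rule eq)
qed

lemma local_translation_transfer:
  assumes "local_translation h x" and x: "x \<in> {0<..<1}"
    and eq: "\<And>y. y \<in> {0..<1} \<Longrightarrow> h y = k y"
  shows "local_translation k x"
proof -
  from assms(1) obtain d where d: "d > 0" "\<And>y. \<bar>y - x\<bar> < d \<Longrightarrow> h y = h x + (y - x)"
    unfolding local_translation_def by blast
  have eq_near: "k y = k x + (y - x)" if "\<bar>y - x\<bar> < min d (min x (1 - x))" for y
  proof -
    have "y \<in> {0..<1}" using that x by (auto simp: abs_if split: if_splits)
    then have "k y = h y" "k x = h x" using eq x by auto
    then show ?thesis using d(2)[of y] that by simp
  qed
  have "min d (min x (1 - x)) > 0" using d(1) x by simp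
  then show ?thesis by (rule local_translationI[of "min d (min x (1 - x))" x k]) (rule eq_near)
qed

lemma breaks_cong:
  assumes "\<And>y. y \<in> {0..<1} \<Longrightarrow> h y = k y"
  shows "breaks h = breaks k"
  using local_translation_transfer[of h _ k] local_translation_transfer[of k _ h] assms
  unfolding breaks_def by auto

text \<open>
  If \<open>h x\<close> were \<open>0\<close>, the translation would take negative values to the left of \<open>x\<close>.
\<close>

lemma local_translation_interior:
  assumes "local_translation h x" and x: "x \<in> {0<..<1}" and h: "h ` {0..<1} \<subseteq> {0..<1}"
  shows "h x \<in> {0<..<1}"
proof -
  from assms(1) obtain d where d: "d > 0" "\<And>y. \<bar>y - x\<bar> < d \<Longrightarrow> h y = h x + (y - x)"
    unfolding local_translation_def by blast
  define y where "y = x - min (d / 2) (x / 2)"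
  have y: "y < x" "\<bar>y - x\<bar> < d" "y \<in> {0..<1}"
    using d(1) x by (auto simp: y_def min_def abs_if)
  have "h y \<ge> 0" "h x \<in> {0..<1}"
    using h y(3) x by (auto simp: image_subset_iff)
  then show ?thesis
    using d(2)[OF y(2)] y(1) by auto
qed

lemma breaks_comp_subset:
  assumes "h ` {0..<1} \<subseteq> {0..<1}"
  shows "breaks (k \<circ> h) \<subseteq> breaks h \<union> {x \<in> {0..<1}. h x \<in> breaks k}"
  using local_translation_comp[of h _ k] local_translation_interior[OF _ _ assms]
  unfolding breaks_def by auto

lemma breaks_comp_finite_card:
  assumes h: "bij_betw h {0..<1} {0..<1}" and fin: "finite (breaks h)" "finite (breaks k)"
  shows "finite (breaks (k \<circ> h)) \<and> card (breaks (k \<circ> h)) \<le> card (breaks h) + card (breaks k)"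
proof -
  let ?P = "{x \<in> {0..<1}. h x \<in> breaks k}"
  have inj: "inj_on h ?P"
    using h by (auto simp: bij_betw_def inj_on_def)
  have im: "h ` ?P \<subseteq> breaks k" by auto
  have finP: "finite ?P" and cardP: "card ?P \<le> card (breaks k)"
    using inj_on_finite[OF inj im fin(2)] card_inj_on_le[OF inj im fin(2)] .
  have sub: "breaks (k \<circ> h) \<subseteq> breaks h \<union> ?P"
    using h by (intro breaks_comp_subset) (simp add: bij_betw_def)
  have "card (breaks (k \<circ> h)) \<le> card (breaks h \<union> ?P)"
    using sub fin(1) finP by (intro card_mono) auto
  also have "\<dots> \<le> card (breaks h) + card ?P" by (rule card_Un_le)
  finally show ?thesis
    using finite_subset[OF sub] fin(1) finP cardP by simp
qed

lemma breaks_funpow_finite_card: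
  assumes h: "bij_betw h {0..<1} {0..<1}" and fin: "finite (breaks h)"
  shows "finite (breaks (h ^^ n)) \<and> card (breaks (h ^^ n)) \<le> n * card (breaks h)"
proof (induction n)
  case 0
  have "breaks (h ^^ 0) = {}"
    by (auto simp: breaks_def local_translation_def intro: exI[of _ 1])
  then show ?case by (simp only: card.empty finite.emptyI simp_thms zero_le)
next
  case (Suc n)
  then show ?case
    using breaks_comp_finite_card[OF h fin, of "h ^^ n"]
    by (auto simp add: funpow_Suc_right simp del: funpow.simps comp_apply)
qed

text \<open>
  Breaks of the outer map can be found among those of a composition: at a point where the inner map
  is a translation, it can be cancelled.  The summand \<open>1\<close> accounts for the image of \<open>0\<close>.
\<close>

lemma breaks_outer_card:
  assumes h: "bij_betw h {0..<1} {0..<1}" and fin: "finite (breaks h)" "finite (breaks (k \<circ> h))"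
  shows "card (breaks k) \<le> card (breaks h) + card (breaks (k \<circ> h)) + 1"
proof -
  let ?S = "insert 0 (breaks h \<union> breaks (k \<circ> h))"
  have "breaks k \<subseteq> h ` ?S"
  proof
    fix y assume y: "y \<in> breaks k"
    then have "y \<in> h ` {0..<1}"
      using h by (auto simp: bij_betw_def breaks_def)
    then obtain x where x: "x \<in> {0..<1}" "y = h x" by blast
    have "x \<in> ?S"
      using local_translation_cancel[of h x k] x y by (auto simp: breaks_def)
    with x show "y \<in> h ` ?S" by blast
  qed
  then have "card (breaks k) \<le> card (h ` ?S)"
    using fin by (intro card_mono) auto
  also have "\<dots> \<le> card ?S" using fin by (intro card_image_le) auto
  also have "\<dots> \<le> Suc (card (breaks h \<union> breaks (k \<circ> h)))"
    by (rule card_insert_le_m1) simp_all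
  also have "\<dots> \<le> Suc (card (breaks h) + card (breaks (k \<circ> h)))"
    using card_Un_le by simp
  finally show ?thesis by simp
qed

section \<open>Breaks of an interval exchange\<close>

lemma subinterval_exists:
  assumes "0 \<le> x" "x < (\<Sum>i = 1..n. lam i)"
  shows "\<exists>i\<in>{1..n}. x \<in> subinterval lam i"
  using assms(2)
proof (induction n)
  case 0
  then show ?case using assms(1) by simp
next
  case (Suc n)
  show ?case
  proof (cases "x < (\<Sum>i = 1..n. lam i)")
    case True
    then show ?thesis using Suc.IH by auto
  next
    case False
    have "left_endpoint lam (Suc n) = (\<Sum>i = 1..n. lam i)"
      by (simp add: left_endpoint_def atLeastLessThanSuc_atLeastAtMost)
    then have "x \<in> subinterval lam (Suc n)"
      using False Suc.prems by (simp add: subinterval_def)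
    then show ?thesis by auto
  qed
qed

lemma iet_on_subinterval:
  assumes "iet_with_lengths n lam f" "i \<in> {1..n}" "x \<in> subinterval lam i"
  shows "f x = f (left_endpoint lam i) + (x - left_endpoint lam i)"
proof -
  obtain t where t: "\<And>x. x \<in> subinterval lam i \<Longrightarrow> f x = x + t"
    using assms(1,2) unfolding iet_with_lengths_def by blast
  have "left_endpoint lam i \<in> subinterval lam i"
    using assms(1,2) by (auto simp: subinterval_def iet_with_lengths_def)
  then show ?thesis using t assms(3) by simp
qed

lemma iet_breaks_subset:
  assumes iet: "iet_with_lengths n lam f"
  shows "breaks f \<subseteq> left_endpoint lam ` {2..n}"
proof
  fix x assume x: "x \<in> breaks f"
  then have "x \<in> {0<..<1}" by (simp add: breaks_def)
  moreover have "(\<Sum>i = 1..n. lam i) = 1"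
    using iet by (simp add: iet_with_lengths_def)
  ultimately obtain i where i: "i \<in> {1..n}" "x \<in> subinterval lam i"
    using subinterval_exists[of x lam n] by auto
  define a b where "a = left_endpoint lam i" and "b = left_endpoint lam i + lam i"
  have ab: "a \<le> x" "x < b" using i(2) by (auto simp: a_def b_def subinterval_def)
  have tr: "f y = f a + (y - a)" if "a \<le> y" "y < b" for y
    using iet_on_subinterval[OF iet i(1), of y] that by (simp add: a_def b_def subinterval_def)
  have "x = a"
  proof (rule ccontr)
    assume "x \<noteq> a"
    then have "min (x - a) (b - x) > 0" using ab by simp
    moreover have "f y = f x + (y - x)" if "\<bar>y - x\<bar> < min (x - a) (b - x)" for y
      using tr[of y] tr[of x] ab that by (auto simp: abs_if split: if_splits)
    ultimately have "local_translation f x"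
      unfolding local_translation_def by blast
    then show False using x by (simp add: breaks_def)
  qed
  moreover have "i \<noteq> 1"
    using x \<open>x = a\<close> by (auto simp: a_def breaks_def left_endpoint_def)
  ultimately show "x \<in> left_endpoint lam ` {2..n}"
    using i(1) by (auto simp: a_def)
qed

lemma iet_breaks_finite_card:
  assumes "is_iet n f"
  shows "finite (breaks f)" "card (breaks f) \<le> n - 1"
proof -
  obtain lam where "iet_with_lengths n lam f"
    using assms by (auto simp: is_iet_def)
  then have sub: "breaks f \<subseteq> left_endpoint lam ` {2..n}"
    by (rule iet_breaks_subset)
  then show "finite (breaks f)" by (rule finite_subset) simp
  have "card (breaks f) \<le> card (left_endpoint lam ` {2..n})"
    using sub by (intro card_mono) auto
  also have "\<dots> \<le> n - 1"
    using card_image_le[of "{2..n}" "left_endpoint lam"] by simp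
  finally show "card (breaks f) \<le> n - 1" .
qed

lemma is_iet_bij: "is_iet n f \<Longrightarrow> bij_betw f {0..<1} {0..<1}"
  by (auto simp: is_iet_def iet_with_lengths_def)

text \<open>
  The conjugacy is used in the form \<open>f\<^sup>n \<circ> g = g \<circ> f\<^sub>0\<^sup>n\<close>: the breaks of the right-hand side are
  bounded by subadditivity, and those of \<open>f\<^sup>n\<close> are recovered by cancelling \<open>g\<close> on the left-hand
  side.
\<close>

lemma old_transformation_breaks_linear:
  assumes "old_transformation m f"
  shows "\<exists>C. \<forall>n. card (breaks (f ^^ n)) \<le> n * (m - 2) + C"
proof -
  obtain l f0 k g where l: "l < m" and f0: "is_iet l f0" and g: "is_iet k g"
    and conj: "\<And>x. x \<in> {0..<1} \<Longrightarrow> f x = g (f0 (inv_into {0..<1} g x))"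
    using assms unfolding old_transformation_def by blast
  note bg = is_iet_bij[OF g] and bf0 = is_iet_bij[OF f0]
  note fg = iet_breaks_finite_card[OF g] and ff0 = iet_breaks_finite_card[OF f0]
  have step: "f (g y) = g (f0 y)" if "y \<in> {0..<1}" for y
    using conj[of "g y"] bg that bij_betwE[OF bg] by (simp add: bij_betw_def inv_into_f_f)
  have f0_in: "(f0 ^^ n) y \<in> {0..<1}" if "y \<in> {0..<1}" for n y
    using that bf0 by (induction n) (auto simp: bij_betw_def)
  have semi: "(f ^^ n) (g y) = g ((f0 ^^ n) y)" if "y \<in> {0..<1}" for n y
    using that step f0_in by (induction n) auto
  have "card (breaks (f ^^ n)) \<le> n * (m - 2) + (2 * card (breaks g) + 1)" for n
  proof -
    have bf0n: "bij_betw (f0 ^^ n) {0..<1} {0..<1}"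
      by (rule bij_betw_funpow[OF bf0])
    have eq: "breaks ((f ^^ n) \<circ> g) = breaks (g \<circ> (f0 ^^ n))"
      using semi by (intro breaks_cong) simp
    have pow: "finite (breaks (f0 ^^ n))" "card (breaks (f0 ^^ n)) \<le> n * card (breaks f0)"
      using breaks_funpow_finite_card[OF bf0 ff0(1)] by auto
    have rhs: "finite (breaks (g \<circ> (f0 ^^ n)))"
      "card (breaks (g \<circ> (f0 ^^ n))) \<le> card (breaks (f0 ^^ n)) + card (breaks g)"
      using breaks_comp_finite_card[OF bf0n pow(1) fg(1)] by auto
    have "n * card (breaks f0) \<le> n * (m - 2)"
      using ff0(2) l by (intro mult_left_mono) auto
    then show ?thesis
      using breaks_outer_card[OF bg fg(1), of "f ^^ n"] rhs pow(2) unfolding eq by linarith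
  qed
  then show ?thesis by blast
qed

section \<open>Order-reversing exchanges of four intervals\<close>

locale keane_4321 =
  fixes f :: "real \<Rightarrow> real" and lam :: "nat \<Rightarrow> real"
  assumes iet: "iet_with_lengths 4 lam f"
    and reversing: "monodromy_invariant 4 lam f = [4, 3, 2, 1]"
    and keane: "keane 4 lam f"
begin

abbreviation d :: "nat \<Rightarrow> real" where "d \<equiv> left_endpoint lam"

lemma bij: "bij_betw f {0..<1} {0..<1}"
  using iet by (simp add: iet_with_lengths_def)

lemma bij_funpow: "bij_betw (f ^^ n) {0..<1} {0..<1}"
  by (rule bij_betw_funpow[OF bij])

lemma funpow_in: "x \<in> {0..<1} \<Longrightarrow> (f ^^ n) x \<in> {0..<1}"
  using bij_funpow[of n] by (auto simp: bij_betw_def)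

lemma funpow_inj:
  assumes "x \<in> {0..<1}" "y \<in> {0..<1}" "(f ^^ n) x = (f ^^ n) y"
  shows "x = y"
  using assms bij_funpow[of n] by (auto simp: bij_betw_def inj_on_def)

lemma endpoint_values:
  "d 1 = 0" "d 2 = lam 1" "d 3 = lam 1 + lam 2" "d 4 = lam 1 + lam 2 + lam 3"
  "lam 1 + lam 2 + lam 3 + lam 4 = 1"
  "lam 1 > 0" "lam 2 > 0" "lam 3 > 0" "lam 4 > 0"
  using iet by (simp_all add: left_endpoint_def iet_with_lengths_def eval_nat_numeral)

lemma four_cases: "(i::nat) \<in> {1..4} \<Longrightarrow> i = 1 \<or> i = 2 \<or> i = 3 \<or> i = 4"
  by auto

lemma endpoint_in: "i \<in> {1..4} \<Longrightarrow> d i \<in> {0..<1}"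
  using endpoint_values four_cases[of i] by auto

lemma endpoint_inj: "i \<in> {1..4} \<Longrightarrow> j \<in> {1..4} \<Longrightarrow> d i = d j \<Longrightarrow> i = j"
  using endpoint_values four_cases[of i] four_cases[of j] by auto

lemma on_interval:
  assumes "i \<in> {1..4}" "0 \<le> s" "s < lam i"
  shows "f (d i + s) = f (d i) + s"
  using iet_on_subinterval[OF iet assms(1), of "d i + s"] assms by (simp add: subinterval_def)

lemma image_less_if_position_less:
  assumes "image_position 4 lam f i < image_position 4 lam f j"
  shows "f (d i) < f (d j)"
proof (rule ccontr)
  assume "\<not> ?thesis"
  then have "image_position 4 lam f j \<le> image_position 4 lam f i"
    unfolding image_position_def by (intro card_mono) auto
  then show False using assms by simp
qed

text \<open>Otherwise \<open>f (d j)\<close> would also be the image of a point of \<open>I\<^sub>i\<close>, against injectivity.\<close>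

lemma image_disjoint:
  assumes "i \<in> {1..4}" "j \<in> {1..4}" "f (d i) < f (d j)"
  shows "f (d i) + lam i \<le> f (d j)"
proof (rule ccontr)
  assume *: "\<not> ?thesis"
  define s where "s = f (d j) - f (d i)"
  have s: "0 \<le> s" "s < lam i" "0 < s" using * assms(3) by (auto simp: s_def)
  then have "f (d i + s) = f (d j)"
    using on_interval[OF assms(1)] by (simp add: s_def)
  moreover have "d i + s \<in> {0..<1}"
    using s endpoint_values four_cases[OF assms(1)] by auto
  ultimately have eq: "d i + s = d j"
    using funpow_inj[of "d i + s" "d j" 1] endpoint_in[OF assms(2)] by simp
  then show False
    using s endpoint_values four_cases[OF assms(1)] four_cases[OF assms(2)] by auto
qed

text \<open>
  The image intervals come in reverse order without overlap inside \<open>[0,1)\<close>, and their lengths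
  add up to \<open>1\<close>; so there is no room for gaps.
\<close>

lemma image_endpoints:
  "f (d 4) = 0" "f (d 3) = f (d 4) + lam 4" "f (d 2) = f (d 3) + lam 3"
  "f (d 1) = f (d 2) + lam 2" "f (d 1) + lam 1 = 1"
proof -
  have pos: "image_position 4 lam f 1 = 4" "image_position 4 lam f 2 = 3"
    "image_position 4 lam f 3 = 2" "image_position 4 lam f 4 = 1"
    using reversing by (simp_all add: monodromy_invariant_def upt_conv_Cons eval_nat_numeral)
  have less: "f (d 4) < f (d 3)" "f (d 3) < f (d 2)" "f (d 2) < f (d 1)"
    by (intro image_less_if_position_less; simp add: pos del: One_nat_def)+
  have le: "f (d 4) + lam 4 \<le> f (d 3)" "f (d 3) + lam 3 \<le> f (d 2)" "f (d 2) + lam 2 \<le> f (d 1)"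
    using less by (auto intro!: image_disjoint)
  have "f (d 4) \<ge> 0"
    using funpow_in[OF endpoint_in[of 4], of 1] by simp
  have "f (d 1) + lam 1 \<le> 1"
  proof (rule ccontr)
    assume *: "\<not> ?thesis"
    have "f (d 1) < 1" using funpow_in[OF endpoint_in[of 1], of 1] by simp
    with * have "f (d 1 + (1 - f (d 1))) = f (d 1) + (1 - f (d 1))"
      by (intro on_interval) auto
    moreover have "d 1 + (1 - f (d 1)) \<in> {0..<1}"
      using * \<open>f (d 1) < 1\<close> endpoint_values by auto
    ultimately show False
      using funpow_in[of "d 1 + (1 - f (d 1))" 1] by simp
  qed
  then show "f (d 4) = 0" "f (d 3) = f (d 4) + lam 4" "f (d 2) = f (d 3) + lam 3"
    "f (d 1) = f (d 2) + lam 2" "f (d 1) + lam 1 = 1"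
    using le \<open>f (d 4) \<ge> 0\<close> endpoint_values by linarith+
qed

lemma keane_avoids: "k \<ge> 1 \<Longrightarrow> i \<in> {1..4} \<Longrightarrow> j \<in> {2..4} \<Longrightarrow> (f ^^ k) (d i) \<noteq> d j"
  using keane by (auto simp: keane_def)

lemma local_translation_at:
  assumes "x \<in> {0<..<1}" "\<And>j. j \<in> {2..4} \<Longrightarrow> x \<noteq> d j"
  shows "local_translation f x"
  using iet_breaks_subset[OF iet] assms unfolding breaks_def by blast

text \<open>
  The endpoint \<open>\<partial>I\<^sub>4\<close> is left out because \<open>f\<close> maps it to \<open>0\<close>.  The orbits of the other endpoints
  do not reach \<open>0\<close>, since they would have to pass through \<open>\<partial>I\<^sub>4\<close>.
\<close>

lemma local_translation_orbit:
  assumes "i \<in> {1..3}" "k \<ge> 1"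
  shows "local_translation f ((f ^^ k) (d i))"
proof (rule local_translation_at)
  have i: "i \<in> {1..4}" using assms(1) by simp
  obtain k' where k: "k = Suc k'" using assms(2) by (cases k) auto
  have "(f ^^ k) (d i) \<noteq> 0"
  proof
    assume "(f ^^ k) (d i) = 0"
    then have "f ((f ^^ k') (d i)) = f (d 4)" by (simp add: k image_endpoints(1))
    then have eq: "(f ^^ k') (d i) = d 4"
      using funpow_inj[of "(f ^^ k') (d i)" "d 4" 1] endpoint_in funpow_in i by simp
    show False
    proof (cases "k' = 0")
      case True
      then show ?thesis using eq endpoint_inj[OF i, of 4] assms(1) by simp
    next
      case False
      then show ?thesis using eq keane_avoids[of k' i 4] i by simp
    qed
  qed
  then show "(f ^^ k) (d i) \<in> {0<..<1}"
    using funpow_in[OF endpoint_in[OF i], of k] by simp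
  show "(f ^^ k) (d i) \<noteq> d j" if "j \<in> {2..4}" for j
    using keane_avoids[OF assms(2) i that] .
qed

lemma local_translation_funpow:
  assumes "\<And>i. i < k \<Longrightarrow> local_translation f ((f ^^ i) x)"
  shows "local_translation (f ^^ k) x"
  using assms
proof (induction k)
  case 0
  then show ?case by (auto simp: local_translation_def intro: exI[of _ 1])
next
  case (Suc k)
  then show ?case using local_translation_comp[of "f ^^ k" x f] by (simp add: less_Suc_eq del: comp_apply)
qed

lemma local_translation_funpow_image:
  assumes "i \<in> {1..3}"
  shows "local_translation (f ^^ k) (f (d i))"
proof (rule local_translation_funpow)
  fix l
  show "local_translation f ((f ^^ l) (f (d i)))"
    using local_translation_orbit[OF assms, of "Suc l"] by (simp add: funpow_swap1)
qed

text \<open>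
  Both sides are the limit of \<open>k \<circ> h\<close> at \<open>x\<close> from the left.  An injective \<open>k\<close> can therefore not
  repair a jump of \<open>h\<close> from \<open>y\<close> to a different value \<open>h x\<close>.
\<close>

lemma repair_identifies:
  assumes "e > 0" "\<And>t. 0 < t \<Longrightarrow> t < e \<Longrightarrow> h (x - t) = y - t"
    and "local_translation k y" "local_translation (k \<circ> h) x"
  shows "k (h x) = k y"
proof -
  obtain a where a: "a > 0" "\<And>z. \<bar>z - y\<bar> < a \<Longrightarrow> k z = k y + (z - y)"
    using assms(3) unfolding local_translation_def by blast
  obtain b where b: "b > 0" "\<And>z. \<bar>z - x\<bar> < b \<Longrightarrow> k (h z) = k (h x) + (z - x)"
    using assms(4) unfolding local_translation_def by auto
  define t where "t = min e (min a b) / 2"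
  have t: "0 < t" "t < e" "t < a" "t < b" using assms(1) a(1) b(1) by (auto simp: t_def)
  show ?thesis
    using assms(2)[OF t(1,2)] a(2)[of "y - t"] b(2)[of "x - t"] t by simp
qed

lemma left_germ:
  assumes "i \<in> {1..4}" "0 < t" "t < lam i"
  shows "f (d i + lam i - t) = f (d i) + lam i - t"
  using on_interval[OF assms(1), of "lam i - t"] assms by (simp add: algebra_simps)

lemma discontinuity_persists:
  assumes "j \<in> {2..4}"
  shows "\<not> local_translation (f ^^ Suc m) (d j)"
proof
  assume lt: "local_translation (f ^^ Suc m) (d j)"
  then have lt1: "local_translation ((f ^^ m) \<circ> f) (d j)"
    by (simp add: funpow_Suc_right del: funpow.simps)
  consider "j = 2" | "j = 3" | "j = 4" using assms by force
  then show False
  proof cases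
    case 1
    have d2: "d 2 = d 1 + lam 1" using endpoint_values by simp
    have germ: "f (d 2 - t) = 1 - t" if "0 < t" "t < lam 1" for t
      using left_germ[of 1 t] that image_endpoints(5) by (simp add: d2 del: One_nat_def)
    show False
    proof (cases m)
      case 0
      have "local_translation id (1::real)"
        by (auto simp: local_translation_def intro: exI[of _ 1])
      then have "f (d 2) = 1"
        using repair_identifies[of "lam 1" f "d 2" 1 id] germ endpoint_values lt1 1 0 by simp
      then show False using funpow_in[OF endpoint_in[of 2], of 1] by simp
    next
      case (Suc m')
      \<comment> \<open>The limit \<open>1\<close> lies outside \<open>[0,1)\<close>, so one more step is taken: \<open>f\<close> sends the right end
        of \<open>I\<^sub>4\<close> to that of \<open>f(I\<^sub>4)\<close>, which is \<open>f(\<partial>I\<^sub>3)\<close>.\<close>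
      have germ2: "(f \<circ> f) (d 2 - t) = f (d 3) - t" if "0 < t" "t < min (lam 1) (lam 4)" for t
      proof -
        have "d 4 + lam 4 = 1" using endpoint_values by simp
        then show ?thesis
          using that germ[of t] left_germ[of 4 t] image_endpoints(2) by simp
      qed
      have lt2: "local_translation ((f ^^ m') \<circ> (f \<circ> f)) (d 2)"
        using lt1 unfolding 1 Suc funpow_Suc_right comp_assoc .
      have "min (lam 1) (lam 4) > 0" using endpoint_values by simp
      from repair_identifies[OF this germ2 _ lt2]
      have "(f ^^ m') ((f \<circ> f) (d 2)) = (f ^^ m') (f (d 3))"
        using local_translation_funpow_image[of 3 m'] by simp
      then have "(f ^^ Suc m') (f (d 2)) = (f ^^ Suc m') (d 3)"
        by (simp add: funpow_Suc_right del: funpow.simps)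
      then have "f (d 2) = d 3"
        using funpow_inj[of "f (d 2)" "d 3" "Suc m'"] funpow_in[OF endpoint_in[of 2], of 1]
          endpoint_in[of 3] by simp
      then show False using keane_avoids[of 1 2 3] by simp
    qed
  next
    case 2
    have d3: "d 3 = d 2 + lam 2" using endpoint_values by simp
    have germ: "f (d 3 - t) = f (d 1) - t" if "0 < t" "t < lam 2" for t
      using left_germ[of 2 t] that image_endpoints(4) by (simp add: d3)
    have "(f ^^ m) (f (d 3)) = (f ^^ m) (f (d 1))"
      using repair_identifies[OF endpoint_values(7) germ _ lt1[unfolded 2]]
        local_translation_funpow_image[of 1 m] by simp
    then have "(f ^^ Suc m) (d 3) = (f ^^ Suc m) (d 1)"
      by (simp add: funpow_Suc_right del: funpow.simps)
    then have "d 3 = d 1"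
      using funpow_inj[of "d 3" "d 1" "Suc m"] endpoint_in[of 3] endpoint_in[of 1] by simp
    then show False using endpoint_inj[of 3 1] by simp
  next
    case 3
    have d4: "d 4 = d 3 + lam 3" using endpoint_values by simp
    have germ: "f (d 4 - t) = f (d 2) - t" if "0 < t" "t < lam 3" for t
      using left_germ[of 3 t] that by (simp add: d4 image_endpoints(3))
    have "(f ^^ m) (f (d 4)) = (f ^^ m) (f (d 2))"
      using repair_identifies[OF endpoint_values(8) germ _ lt1[unfolded 3]]
        local_translation_funpow_image[of 2 m] by simp
    then have "(f ^^ Suc m) (d 4) = (f ^^ Suc m) (d 2)"
      by (simp add: funpow_Suc_right del: funpow.simps)
    then have "d 4 = d 2"
      using funpow_inj[of "d 4" "d 2" "Suc m"] endpoint_in[of 4] endpoint_in[of 2] by simp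
    then show False using endpoint_inj[of 4 2] by simp
  qed
qed

text \<open>
  Before its orbit reaches \<open>\<partial>I\<^sub>j\<close>, a preimage of \<open>\<partial>I\<^sub>j\<close> meets neither \<open>0\<close> nor a discontinuity, so
  \<open>f ^^ k\<close> carries the break of \<open>f ^^ (n - k)\<close> at \<open>\<partial>I\<^sub>j\<close> back to it.
\<close>

lemma preimage_is_break:
  assumes x: "x \<in> {0..<1}" and j: "j \<in> {2..4}" and k: "(f ^^ k) x = d j" "k < n"
  shows "x \<in> breaks (f ^^ n)"
proof -
  have avoid: "(f ^^ i) x \<noteq> d l" if "i < k" "l \<in> {1..4}" for i l
  proof
    assume "(f ^^ i) x = d l"
    then have "(f ^^ (k - i)) (d l) = (f ^^ (k - i + i)) x"
      by (simp only: funpow_add comp_apply)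
    then have "(f ^^ (k - i)) (d l) = d j" using k(1) that(1) by simp
    then show False using keane_avoids[OF _ that(2) j, of "k - i"] that(1) by auto
  qed
  have nz: "(f ^^ i) x \<in> {0<..<1}" if "i < k" for i
    using funpow_in[OF x, of i] avoid[OF that, of 1] endpoint_values(1) by simp
  have ltk: "local_translation (f ^^ k) x"
    using nz avoid by (intro local_translation_funpow local_translation_at) auto
  have "x \<noteq> 0"
  proof (cases "k = 0")
    case True
    then show ?thesis using k(1) endpoint_inj[of j 1] endpoint_values(1) j by auto
  next
    case False
    then show ?thesis using nz[of 0] by simp
  qed
  obtain m where m: "n = Suc m + k"
    using k(2) less_imp_Suc_add by (metis add.commute add_Suc_right)
  have "\<not> local_translation (f ^^ n) x"
  proof
    assume "local_translation (f ^^ n) x"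
    then have "local_translation ((f ^^ Suc m) \<circ> (f ^^ k)) x"
      by (simp only: m funpow_add)
    from local_translation_cancel[OF ltk this] show False
      using discontinuity_persists[OF j, of m] k(1) by simp
  qed
  then show ?thesis using x \<open>x \<noteq> 0\<close> by (simp add: breaks_def)
qed

lemma breaks_funpow_card: "3 * n \<le> card (breaks (f ^^ n))"
proof -
  define p where "p = (\<lambda>(k, j). inv_into {0..<1} (f ^^ k) (d j))"
  have d_in: "d j \<in> (f ^^ k) ` {0..<1}" if "j \<in> {2..4}" for k j
    using bij_funpow[of k] endpoint_in[of j] that by (simp add: bij_betw_def)
  have p: "p (k, j) \<in> {0..<1}" "(f ^^ k) (p (k, j)) = d j" if "j \<in> {2..4}" for k j
    using inv_into_into[OF d_in[OF that]] f_inv_into_f[OF d_in[OF that]] by (simp_all add: p_def)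
  have no_later: "\<not> k < l" if eq: "p (k, i) = p (l, j)" and ij: "i \<in> {2..4}" "j \<in> {2..4}" for k l i j
  proof
    assume "k < l"
    have "(f ^^ (l - k)) (d i) = (f ^^ (l - k + k)) (p (k, i))"
      using p(2)[OF ij(1), of k] by (simp only: funpow_add comp_apply)
    also have "\<dots> = d j" using p(2)[OF ij(2), of l] eq \<open>k < l\<close> by simp
    finally have "(f ^^ (l - k)) (d i) = d j" .
    moreover have "l - k \<ge> 1" using \<open>k < l\<close> by linarith
    ultimately show False using keane_avoids[of "l - k" i j] ij by simp
  qed
  have "inj_on p ({..<n} \<times> {2..4})"
  proof (rule inj_onI)
    fix a b assume "a \<in> {..<n} \<times> {2..4}" "b \<in> {..<n} \<times> {2..4}" and eq: "p a = p b"
    then obtain k i l j where ab: "a = (k, i)" "b = (l, j)" and ij: "i \<in> {2..4}" "j \<in> {2..4}"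
      by auto
    have "k = l"
      using no_later[of k i l j] no_later[of l j k i] eq ab ij by auto
    then have "d i = d j"
      using p(2)[OF ij(1), of k] p(2)[OF ij(2), of l] eq ab by simp
    then show "a = b" using ab \<open>k = l\<close> endpoint_inj[of i j] ij by simp
  qed
  moreover have "p ` ({..<n} \<times> {2..4}) \<subseteq> breaks (f ^^ n)"
    using p by (auto intro!: preimage_is_break)
  moreover have "finite (breaks (f ^^ n))"
  proof -
    have "finite (breaks f)"
      using iet iet_breaks_finite_card(1) by (auto simp: is_iet_def)
    then show ?thesis using breaks_funpow_finite_card[OF bij] by simp
  qed
  ultimately have "card ({..<n} \<times> {2..4::nat}) \<le> card (breaks (f ^^ n))"
    by (rule card_inj_on_le)
  then show ?thesis by (simp add: card_cartesian_product mult.commute)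
qed

end

section \<open>The exchange is new\<close>

theorem proposition2p8:
  fixes f :: "real \<Rightarrow> real" and lam :: "nat \<Rightarrow> real"
  assumes "iet_with_lengths 4 lam f"
    and "monodromy_invariant 4 lam f = [4, 3, 2, 1]"
    and "keane 4 lam f"
    and "\<not> continuous (at (inv_into {0..<1} f 0) within {0..<1}) (f ^^ 2)"
  shows "new_transformation 4 f"
proof -
  interpret keane_4321 f lam
    using assms(1-3) by unfold_locales
  have "\<not> old_transformation 4 f"
  proof
    assume "old_transformation 4 f"
    then obtain C where upper: "\<And>n. card (breaks (f ^^ n)) \<le> n * (4 - 2) + C"
      using old_transformation_breaks_linear by blast
    show False
      using upper[of "Suc C"] breaks_funpow_card[of "Suc C"] by simp
  qed
  moreover have "is_iet 4 f"
    using assms(1) by (auto simp: is_iet_def)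
  ultimately show ?thesis by (simp add: new_transformation_def)
qed

end
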